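(* Let $f:\mathbb R^n\to\mathbb R$ and $\varepsilon:\mathbb R^n\to\mathbb R_+$ be continuous functions, and let $F:\mathbb R^n\to\mathbb R^n$ be a consistency-enforcing mapping (with respect to $f$ and $\varepsilon$). Then for every $x\in\mathbb R^n$ it holds that $\lim_{i\to\infty}\varepsilon(F^i(x))=0$.
   Context: $\mathbb R_+$ is the set of non-negative reals, $\|\cdot\|$ is the Euclidean norm, and $F^i$ denotes the $i$-fold composition of $F$ with itself. Given continuous $f:\mathbb R^n\to\mathbb R$ and continuous $\varepsilon:\mathbb R^n\to\mathbb R_+$, a mapping $F:\mathbb R^n\to\mathbb R^n$ is called consistency-enforcing if all of the following hold: (1) $F$ is continuous; (2) $f(F(x))\ge f(x)$ for all $x\in\mathbb R^n$; (3) for any $x\in\mathbb R^n$ there exists $M\in\mathbb R$ such that $f(F^i(x))<M$ for any $i$; (4) for all $x\in\mathbb R^n$ there exists $C_x>0$ such that $\|F^i(x)\|\le C_x$ for any $i$; (5) for all $x\in\mathbb R^n$ there exists $M_x\in\mathbb R$ such that $\varepsilon(F^i(x))<M_x$ for any $i$; (6) there is a natural number $N>0$ such that, for all $x\in\mathbb R^n$, $f(F^N(x))=f(x)$ implies $\varepsilon(x)=0$. *)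

theory Defs
  imports "HOL-Analysis.Analysis"
begin

definition consistency_enforcing ::
  "(real ^ 'n \<Rightarrow> real) \<Rightarrow> (real ^ 'n \<Rightarrow> real) \<Rightarrow> (real ^ 'n \<Rightarrow> real ^ 'n) \<Rightarrow> bool"
where
  "consistency_enforcing f \<epsilon> F \<longleftrightarrow>
     continuous_on UNIV F \<and>
     (\<forall>x. f (F x) \<ge> f x) \<and>
     (\<forall>x. \<exists>M. \<forall>i. f ((F ^^ i) x) < M) \<and>
     (\<forall>x. \<exists>C>0. \<forall>i. norm ((F ^^ i) x) \<le> C) \<and>
     (\<forall>x. \<exists>M. \<forall>i. \<epsilon> ((F ^^ i) x) < M) \<and>
     (\<exists>N>0. \<forall>x. f ((F ^^ N) x) = f x \<longrightarrow> \<epsilon> x = 0)"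

end

(* The values f(F^i x) increase to a limit L. If \<epsilon>(F^i x) did not tend to 0, the bounded orbit would
   have a cluster point p with \<epsilon>(p) > 0. By continuity f(p) = L = f(F^N p), hence \<epsilon>(p) = 0. *)
theory Submission
  imports Defs
begin

theorem theorem8p3:
  fixes f \<epsilon> :: "real ^ 'n \<Rightarrow> real"
    and F :: "real ^ 'n \<Rightarrow> real ^ 'n"
  assumes "continuous_on UNIV f"
    and "continuous_on UNIV \<epsilon>"
    and "\<And>x. \<epsilon> x \<ge> 0"
    and "consistency_enforcing f \<epsilon> F"
  shows "\<forall>x. (\<lambda>i. \<epsilon> ((F ^^ i) x)) \<longlonglongrightarrow> 0"
proof (rule allI, rule ccontr)
  fix x
  assume "\<not> (\<lambda>i. \<epsilon> ((F ^^ i) x)) \<longlonglongrightarrow> 0"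
  \<comment> \<open>Since \<epsilon> is nonnegative, the absolute value in the negated limit drops
    out.\<close>
  then obtain \<delta> where "\<delta> > 0" and freq: "\<forall>n. \<exists>i\<ge>n. \<epsilon> ((F ^^ i) x) \<ge> \<delta>"
    using assms(3) by (auto simp: LIMSEQ_iff not_less)
  have contF: "continuous_on UNIV F" and mono: "\<And>y. f y \<le> f (F y)"
    using assms(4) by (auto simp: consistency_enforcing_def)
  obtain M where M: "\<And>i. f ((F ^^ i) x) < M"
    using assms(4) unfolding consistency_enforcing_def by blast
  obtain C where C: "\<And>i. norm ((F ^^ i) x) \<le> C"
    using assms(4) unfolding consistency_enforcing_def by blast
  obtain N where N: "\<And>y. f ((F ^^ N) y) = f y \<Longrightarrow> \<epsilon> y = 0"
    using assms(4) unfolding consistency_enforcing_def by blast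
  have "incseq (\<lambda>i. f ((F ^^ i) x))"
    by (simp add: incseq_Suc_iff mono)
  then obtain L where L: "(\<lambda>i. f ((F ^^ i) x)) \<longlonglongrightarrow> L"
    using M by (metis incseq_convergent less_imp_le)
  have "infinite {i. \<epsilon> ((F ^^ i) x) \<ge> \<delta>}"
    using freq by (auto simp: infinite_nat_iff_unbounded_le)
  then obtain s :: "nat \<Rightarrow> nat"
    where s: "strict_mono s" "\<And>k. \<epsilon> ((F ^^ s k) x) \<ge> \<delta>"
    using infinite_enumerate by blast
  have "\<forall>k. (F ^^ s k) x \<in> cball 0 C"
    \<comment> \<open>Bounded orbits enter here: \<open>compact_def\<close> is sequential
      compactness, so the indices \<open>s k\<close> can be thinned to a convergent
      subsequence.\<close>
    using C by simp
  then obtain p r where r: "strict_mono r" "((\<lambda>k. (F ^^ s k) x) \<circ> r) \<longlonglongrightarrow> p"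
    using compact_cball unfolding compact_def by metis
  define t where "t = s \<circ> r"
  have t: "strict_mono t" and p: "(\<lambda>k. (F ^^ t k) x) \<longlonglongrightarrow> p"
    using s(1) r by (auto simp: t_def strict_mono_def o_def)
  have lim: "(\<lambda>k. g ((F ^^ t k) x)) \<longlonglongrightarrow> g p" if "continuous_on UNIV g"
    for g :: "real ^ 'n \<Rightarrow> real"
    using continuous_on_tendsto_compose[OF that p] by simp
  have contFN: "continuous_on UNIV (F ^^ m)" for m
    by (induction m) (auto simp: o_def id_def intro: continuous_on_compose2[OF contF])
  \<comment> \<open>Both sides are limits of one sequence: by continuity of \<open>f\<close>
    composed with \<open>F ^^ m\<close>, and because the indices \<open>m + t k\<close> again select
    a subsequence of the convergent values of \<open>f\<close> along the orbit.\<close>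
  have eq_L: "f ((F ^^ m) p) = L" for m
  proof (rule LIMSEQ_unique)
    have "continuous_on UNIV (\<lambda>y. f ((F ^^ m) y))"
      by (rule continuous_on_compose2[OF assms(1) contFN]) simp
    then show "(\<lambda>k. f ((F ^^ m) ((F ^^ t k) x))) \<longlonglongrightarrow> f ((F ^^ m) p)"
      by (rule lim)
    have "strict_mono (\<lambda>k. m + t k)"
      using t by (simp add: strict_mono_def)
    from LIMSEQ_subseq_LIMSEQ[OF L this]
    show "(\<lambda>k. f ((F ^^ m) ((F ^^ t k) x))) \<longlonglongrightarrow> L"
      by (simp add: o_def funpow_add)
  qed
  have "\<epsilon> p = 0"
    \<comment> \<open>The case \<open>m = 0\<close> reads \<open>f p = L\<close>, so
      \<open>f\<close> takes the same value at \<open>p\<close> and at its \<open>N\<close>-th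
      iterate.\<close>
    using N eq_L[of N] eq_L[of 0] by simp
  moreover have "\<delta> \<le> \<epsilon> p"
    \<comment> \<open>The lower bound \<delta> holds at every index \<open>s k\<close>, hence along
      \<open>t\<close>, and survives the limit.\<close>
    using s(2) by (intro LIMSEQ_le_const[OF lim[OF assms(2)]]) (auto simp: t_def)
  ultimately show False
    using \<open>\<delta> > 0\<close> by simp
qed

end
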